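(* Let $E$ be a finite-dimensional real vector space, let $\mathcal G:E\to E^*$ be an oracle, $x_0\in E$, $R>0$, and assume there is $x^*\in B(x_0,R)$ with $\langle \mathcal G(x),x-x^*\rangle\ge 0$ for all $x\in E$. Fix $\delta>0$ and run the General Scheme (see context) with arbitrary coefficients $a_k,b_k\ge 0$; call an iteration $k$ terminal if $U_k\le\delta\|g_k\|_*$ and stop the scheme at the first terminal iteration. Assume all produced $g_k$ are nonzero. Put $Q_i=\Omega_i\cap L_i^-$. (i) Let $k\ge 1$ be an iteration that is reached (so iterations $0,\dots,k-1$ are nonterminal) and suppose $\Gamma_k=\sum_{i=0}^{k-1}a_i\|g_i\|_*>0$. Then the Augmentation Algorithm (see context) applied with $Q_0,\dots,Q_k$ to $s_k=-\sum_{i=0}^{k-1}a_ig_i$ is well defined (the required dual multipliers exist), and if $\mu_0,\dots,\mu_{k-1}\ge 0$ are the multipliers it produces and $\lambda_i=a_i+\mu_i$, then $\Gamma_k(\lambda)=\sum_{i=0}^{k-1}\lambda_i\|g_i\|_*\ge\Gamma_k>0$ and $$\max_{x\in B(x_0,R)}\frac{1}{\Gamma_k(\lambda)}\sum_{i=0}^{k-1}\lambda_i\langle g_i,x_i-x\rangle\ \le\ \Delta_k .$$ (ii) Let $k\ge 0$ be the terminal iteration. Then the Augmentation Algorithm applied with $Q_0,\dots,Q_k$ to $s_k=-g_k$ is well defined, and if $\mu_0,\dots,\mu_{k-1}\ge 0$ are the multipliers it produces and $\lambda=(\mu_0,\dots,\mu_{k-1},1)$, then $$\max_{x\in B(x_0,R)}\frac{1}{\sum_{i=0}^{k}\lambda_i\|g_i\|_*}\sum_{i=0}^{k}\lambda_i\langle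 g_i,x_i-x\rangle\ \le\ \delta .$$
   Context: $E^*$ is the dual of $E$ and $\langle s,x\rangle$ is the value of $s\in E^*$ at $x\in E$. A self-adjoint positive definite operator $B:E\to E^*$ is fixed; $\|x\|=\langle Bx,x\rangle^{1/2}$, $\|s\|_*=\langle s,B^{-1}s\rangle^{1/2}$, $B(x_0,R)=\{x\in E:\|x-x_0\|\le R\}$. General Scheme. Put $\ell_0(x)=0$, $\omega_0(x)=\frac12\|x-x_0\|^2$. For $k\ge 0$: (1) $g_k=\mathcal G(x_k)$; (2) $U_k=\max_{x\in\Omega_k\cap L_k^-}\langle g_k,x_k-x\rangle$, where $\Omega_k=\{x\in E:\omega_k(x)\le\frac12R^2\}$ and $L_k^-=\{x\in E:\ell_k(x)\le 0\}$; (3) choose $a_k,b_k\ge 0$ and set $\ell_{k+1}(x)=\ell_k(x)+a_k\langle g_k,x-x_k\rangle$ and $\omega_{k+1}(x)=\omega_k(x)+\frac12 b_k\bigl(U_k-\langle g_k,x_k-x\rangle\bigr)\langle g_k,x-x_k\rangle$; (4) $x_{k+1}=\arg\min_{x\in E}[\ell_{k+1}(x)+\omega_{k+1}(x)]$. The termination test is performed in step (2). Sliding gap: for $k\ge 1$ with $\Gamma_k>0$, $\Delta_k=\max_{x\in\Omega_k}\frac{1}{\Gamma_k}\sum_{i=0}^{k-1}a_i\langle g_i,x_i-x\rangle$. Augmentation Algorithm. Given sets $Q_0,\dots,Q_k\subseteq E$, points $x_i\in E$ and $g_i\in E^*$ ($0\le i\le k-1$), let $\hat Q_i=\{x\in Q_i:\langle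 g_i,x-x_i\rangle\le 0\}$. Given $s_k\in E^*$, for $i=k-1,\dots,0$: compute a dual multiplier $\mu_i\ge 0$, i.e. any number satisfying $\max_{x\in\hat Q_i}\langle s_{i+1},x\rangle=\max_{x\in Q_i}[\langle s_{i+1},x\rangle+\mu_i\langle g_i,x_i-x\rangle]$, and set $s_i=s_{i+1}-\mu_ig_i$. (For $k=0$ nothing is done.) *)

theory Defs
  imports "HOL-Analysis.Analysis"
begin

text \<open>
  The space E is an arbitrary type of class \<^class>\<open>euclidean_space\<close>, and its dual is the type
  of bounded linear functionals on it. The norms in use are the ones given by the
  operator B below, never the norm or the inner product of the type class.
\<close>

definition self_adjoint_pos_def :: "('a::euclidean_space \<Rightarrow> 'a \<Rightarrow>\<^sub>L real) \<Rightarrow> bool" where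
  "self_adjoint_pos_def B \<longleftrightarrow>
     linear B \<and> (\<forall>x y. B x y = B y x) \<and> (\<forall>x. x \<noteq> 0 \<longrightarrow> B x x > 0)"

definition primal_norm :: "('a::euclidean_space \<Rightarrow> 'a \<Rightarrow>\<^sub>L real) \<Rightarrow> 'a \<Rightarrow> real" where
  "primal_norm B x = sqrt (B x x)"

definition dual_norm :: "('a::euclidean_space \<Rightarrow> 'a \<Rightarrow>\<^sub>L real) \<Rightarrow> ('a \<Rightarrow>\<^sub>L real) \<Rightarrow> real" where
  "dual_norm B s = sqrt (s (inv B s))"

definition primal_ball :: "('a::euclidean_space \<Rightarrow> 'a \<Rightarrow>\<^sub>L real) \<Rightarrow> 'a \<Rightarrow> real \<Rightarrow> 'a set" where
  "primal_ball B x0 R = {x. primal_norm B (x - x0) \<le> R}"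

definition has_maximum :: "('a \<Rightarrow> real) \<Rightarrow> 'a set \<Rightarrow> real \<Rightarrow> bool" where
  "has_maximum f S m \<longleftrightarrow> (\<exists>x\<in>S. f x = m) \<and> (\<forall>x\<in>S. f x \<le> m)"

text \<open>Unspecified if the maximum is not attained.\<close>

definition maximum :: "('a \<Rightarrow> real) \<Rightarrow> 'a set \<Rightarrow> real" where
  "maximum f S = (THE m. has_maximum f S m)"

definition Omega_set :: "real \<Rightarrow> (nat \<Rightarrow> 'a \<Rightarrow> real) \<Rightarrow> nat \<Rightarrow> 'a set" where
  "Omega_set R \<omega> k = {z. \<omega> k z \<le> 1/2 * R^2}"

definition L_minus :: "(nat \<Rightarrow> 'a \<Rightarrow> real) \<Rightarrow> nat \<Rightarrow> 'a set" where
  "L_minus ell k = {z. ell k z \<le> 0}"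

definition terminal ::
  "('a::euclidean_space \<Rightarrow> 'a \<Rightarrow>\<^sub>L real) \<Rightarrow> real \<Rightarrow> (nat \<Rightarrow> 'a \<Rightarrow>\<^sub>L real) \<Rightarrow> (nat \<Rightarrow> real) \<Rightarrow> nat \<Rightarrow> bool"
where
  "terminal B \<delta> g U k \<longleftrightarrow> U k \<le> \<delta> * dual_norm B (g k)"

definition reached ::
  "('a::euclidean_space \<Rightarrow> 'a \<Rightarrow>\<^sub>L real) \<Rightarrow> real \<Rightarrow> (nat \<Rightarrow> 'a \<Rightarrow>\<^sub>L real) \<Rightarrow> (nat \<Rightarrow> real) \<Rightarrow> nat \<Rightarrow> bool"
where
  "reached B \<delta> g U k \<longleftrightarrow> (\<forall>i<k. \<not> terminal B \<delta> g U i)"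

text \<open>
  A run of the General Scheme, stopped at the first terminal iteration: steps (1) and (2)
  are carried out in every reached iteration, and steps (3) and (4) in every reached
  iteration that is not terminal, that is, those \<open>k\<close> for which \<open>Suc k\<close> is reached. Members of
  the sequences beyond the last iteration are unconstrained.
\<close>

definition general_scheme ::
  "('a::euclidean_space \<Rightarrow> 'a \<Rightarrow>\<^sub>L real) \<Rightarrow> ('a \<Rightarrow> 'a \<Rightarrow>\<^sub>L real) \<Rightarrow> 'a \<Rightarrow> real \<Rightarrow> real \<Rightarrow>
   (nat \<Rightarrow> real) \<Rightarrow> (nat \<Rightarrow> real) \<Rightarrow> (nat \<Rightarrow> 'a) \<Rightarrow> (nat \<Rightarrow> 'a \<Rightarrow>\<^sub>L real) \<Rightarrow> (nat \<Rightarrow> real) \<Rightarrow>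
   (nat \<Rightarrow> 'a \<Rightarrow> real) \<Rightarrow> (nat \<Rightarrow> 'a \<Rightarrow> real) \<Rightarrow> bool"
where
  "general_scheme B G x0 R \<delta> a b x g U ell \<omega> \<longleftrightarrow>
     x 0 = x0 \<and>
     (\<forall>z. ell 0 z = 0) \<and>
     (\<forall>z. \<omega> 0 z = 1/2 * (primal_norm B (z - x0))^2) \<and>
     (\<forall>k. reached B \<delta> g U k \<longrightarrow>
        g k = G (x k) \<and>
        U k = maximum (\<lambda>z. g k (x k - z)) (Omega_set R \<omega> k \<inter> L_minus ell k)) \<and>
     (\<forall>k. reached B \<delta> g U (Suc k) \<longrightarrow>
        a k \<ge> 0 \<and> b k \<ge> 0 \<and>
        (\<forall>z. ell (Suc k) z = ell k z + a k * g k (z - x k)) \<and>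
        (\<forall>z. \<omega> (Suc k) z =
               \<omega> k z + 1/2 * b k * (U k - g k (x k - z)) * g k (z - x k)) \<and>
        x (Suc k) = arg_min_on (\<lambda>z. ell (Suc k) z + \<omega> (Suc k) z) UNIV)"

text \<open>Here \<open>n\<close> is the number of terms of the certificate.\<close>

definition weight_sum ::
  "('a::euclidean_space \<Rightarrow> 'a \<Rightarrow>\<^sub>L real) \<Rightarrow> (nat \<Rightarrow> 'a \<Rightarrow>\<^sub>L real) \<Rightarrow> (nat \<Rightarrow> real) \<Rightarrow> nat \<Rightarrow> real"
where
  "weight_sum B g c n = (\<Sum>i<n. c i * dual_norm B (g i))"

definition gap_function ::
  "('a::euclidean_space \<Rightarrow> 'a \<Rightarrow>\<^sub>L real) \<Rightarrow> (nat \<Rightarrow> 'a) \<Rightarrow> (nat \<Rightarrow> 'a \<Rightarrow>\<^sub>L real) \<Rightarrow> (nat \<Rightarrow> real) \<Rightarrow>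
   nat \<Rightarrow> 'a \<Rightarrow> real"
where
  "gap_function B x g c n z = 1 / weight_sum B g c n * (\<Sum>i<n. c i * g i (x i - z))"

definition is_sliding_gap ::
  "('a::euclidean_space \<Rightarrow> 'a \<Rightarrow>\<^sub>L real) \<Rightarrow> real \<Rightarrow> (nat \<Rightarrow> real) \<Rightarrow> (nat \<Rightarrow> 'a) \<Rightarrow>
   (nat \<Rightarrow> 'a \<Rightarrow>\<^sub>L real) \<Rightarrow> (nat \<Rightarrow> 'a \<Rightarrow> real) \<Rightarrow> nat \<Rightarrow> real \<Rightarrow> bool"
where
  "is_sliding_gap B R a x g \<omega> k \<Delta> \<longleftrightarrow>
     has_maximum (gap_function B x g a k) (Omega_set R \<omega> k) \<Delta>"

text \<open>
  The equality of the two maxima in the definition of a dual multiplier includes that both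
  are attained.
\<close>

definition dual_multiplier ::
  "'a::euclidean_space set \<Rightarrow> 'a \<Rightarrow> ('a \<Rightarrow>\<^sub>L real) \<Rightarrow> ('a \<Rightarrow>\<^sub>L real) \<Rightarrow> real \<Rightarrow> bool"
where
  "dual_multiplier Qi xi gi s \<mu> \<longleftrightarrow>
     \<mu> \<ge> 0 \<and>
     (\<exists>m. has_maximum (\<lambda>z. s z) {z \<in> Qi. gi (z - xi) \<le> 0} m \<and>
          has_maximum (\<lambda>z. s z + \<mu> * gi (xi - z)) Qi m)"

text \<open>
  The steps \<open>i = k - 1, \<dots>, j\<close> of the Augmentation Algorithm have been carried out with
  input \<open>sk\<close>, producing the multipliers \<open>\<mu> i\<close> and the functionals \<open>s i\<close>; for \<open>j = 0\<close> the run
  is complete.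
\<close>

definition augmentation_run ::
  "(nat \<Rightarrow> 'a::euclidean_space set) \<Rightarrow> (nat \<Rightarrow> 'a) \<Rightarrow> (nat \<Rightarrow> 'a \<Rightarrow>\<^sub>L real) \<Rightarrow> nat \<Rightarrow>
   ('a \<Rightarrow>\<^sub>L real) \<Rightarrow> nat \<Rightarrow> (nat \<Rightarrow> 'a \<Rightarrow>\<^sub>L real) \<Rightarrow> (nat \<Rightarrow> real) \<Rightarrow> bool"
where
  "augmentation_run Q x g k sk j s \<mu> \<longleftrightarrow>
     s k = sk \<and>
     (\<forall>i. j \<le> i \<and> i < k \<longrightarrow>
        dual_multiplier (Q i) (x i) (g i) (s (Suc i)) (\<mu> i) \<and>
        s i = s (Suc i) - \<mu> i *\<^sub>R g i)"

text \<open>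
  A dual multiplier need not be unique, so well-definedness says that the algorithm can
  continue at every step, whichever multipliers were chosen in the steps before it.
\<close>

definition augmentation_well_defined ::
  "(nat \<Rightarrow> 'a::euclidean_space set) \<Rightarrow> (nat \<Rightarrow> 'a) \<Rightarrow> (nat \<Rightarrow> 'a \<Rightarrow>\<^sub>L real) \<Rightarrow> nat \<Rightarrow>
   ('a \<Rightarrow>\<^sub>L real) \<Rightarrow> bool"
where
  "augmentation_well_defined Q x g k sk \<longleftrightarrow>
     (\<forall>j s \<mu>. j < k \<and> augmentation_run Q x g k sk (Suc j) s \<mu> \<longrightarrow>
        (\<exists>m. dual_multiplier (Q j) (x j) (g j) (s (Suc j)) m))"

end

(* The cut of Q_i by the oracle inequality lies in Q_(i+1), since there both updates are
   nonpositive. Moving a multiplier into s_i replaces the maximum over the cut of Q_i by a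
   maximum over all of Q_i, so the maxima telescope down to Q_0, which is the ball B(x0, R).
   The multipliers exist because a nonterminal iteration has U_i > 0, and a point attaining
   U_i is a Slater point for the single linear constraint of Q_i. *)
theory Submission
  imports Defs
begin

section \<open>The norms of a positive definite operator\<close>

text \<open>Makes \<open>inv B\<close> a right inverse of \<open>B\<close>, without which
  \<open>dual_norm\<close> would say nothing. Composing \<open>B\<close> with the coordinate form of
  Riesz representation gives an injective endomorphism of a finite-dimensional space, which is
  therefore onto.\<close>

lemma self_adjoint_pos_def_surj:
  fixes B :: "'a::euclidean_space \<Rightarrow> 'a \<Rightarrow>\<^sub>L real"
  assumes "self_adjoint_pos_def B"
  shows "surj B"
proof
  show "UNIV \<subseteq> range B"
  proof
    fix s :: "'a \<Rightarrow>\<^sub>L real"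
    have lin: "linear B" using assms by (simp add: self_adjoint_pos_def_def)
    define \<phi> where "\<phi> w = (\<Sum>i\<in>Basis. B w i *\<^sub>R i)" for w
    have riesz: "f y = (\<Sum>i\<in>Basis. f i *\<^sub>R i) \<bullet> y" for f :: "'a \<Rightarrow>\<^sub>L real" and y
    proof -
      have "f y = f (\<Sum>i\<in>Basis. (y \<bullet> i) *\<^sub>R i)" by (simp add: euclidean_representation)
      also have "\<dots> = (\<Sum>i\<in>Basis. f i *\<^sub>R i) \<bullet> y"
        by (simp add: blinfun.sum_right blinfun.scaleR_right inner_sum_left
            mult.commute inner_commute[of y])
      finally show ?thesis .
    qed
    have "linear \<phi>"
      unfolding \<phi>_def
      by (rule linearI)
        (simp_all add: linear_add[OF lin] linear_scale[OF lin] blinfun.add_left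
          blinfun.scaleR_left scaleR_add_left sum.distrib scaleR_sum_right)
    moreover have "w = 0" if "\<phi> w = 0" for w
    proof -
      have "B w w = \<phi> w \<bullet> w" unfolding \<phi>_def by (rule riesz)
      with that have "B w w = 0" by simp
      then show ?thesis using assms unfolding self_adjoint_pos_def_def by force
    qed
    ultimately have "surj \<phi>"
      by (simp add: linear_injective_imp_surjective linear_injective_0)
    then obtain w where w: "\<phi> w = (\<Sum>i\<in>Basis. s i *\<^sub>R i)" by (metis surjD)
    have "B w = s"
    proof (rule blinfun_eqI)
      fix y
      have "B w y = \<phi> w \<bullet> y" unfolding \<phi>_def by (rule riesz)
      also have "\<dots> = s y" by (simp only: w riesz[of s y])
      finally show "B w y = s y" .
    qed
    then show "s \<in> range B" by blast
  qed
qed simp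

lemma self_adjoint_pos_def_nonneg:
  assumes "self_adjoint_pos_def B"
  shows "B z z \<ge> 0"
  using assms by (cases "z = 0") (auto simp: self_adjoint_pos_def_def less_imp_le)

lemma dual_norm_nonneg:
  assumes "self_adjoint_pos_def B"
  shows "dual_norm B s \<ge> 0"
proof -
  have "B (inv B s) = s" using self_adjoint_pos_def_surj[OF assms] by (simp add: surj_f_inv_f)
  then show ?thesis
    using self_adjoint_pos_def_nonneg[OF assms, of "inv B s"] by (simp add: dual_norm_def)
qed

lemma dual_norm_pos:
  assumes "self_adjoint_pos_def B" and "s \<noteq> 0"
  shows "dual_norm B s > 0"
proof -
  have eq: "B (inv B s) = s"
    using self_adjoint_pos_def_surj[OF assms(1)] by (simp add: surj_f_inv_f)
  have "B 0 = 0" using assms(1) by (auto simp: self_adjoint_pos_def_def linear_0)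
  then have "inv B s \<noteq> 0" using eq assms(2) by force
  then have "B (inv B s) (inv B s) > 0" using assms(1) by (simp add: self_adjoint_pos_def_def)
  then show ?thesis by (simp add: dual_norm_def eq)
qed

lemma primal_norm_power2:
  assumes "self_adjoint_pos_def B"
  shows "(primal_norm B z)\<^sup>2 = B z z"
  using self_adjoint_pos_def_nonneg[OF assms] by (simp add: primal_norm_def)

lemma continuous_on_primal_norm:
  fixes B :: "'a::euclidean_space \<Rightarrow> 'a \<Rightarrow>\<^sub>L real"
  assumes "self_adjoint_pos_def B"
  shows "continuous_on S (\<lambda>z. primal_norm B (z - c))"
proof -
  have "bounded_linear B"
    using assms by (simp add: self_adjoint_pos_def_def linear_conv_bounded_linear)
  then have "continuous_on S (\<lambda>z. B (z - c))"
    by (rule bounded_linear.continuous_on) (intro continuous_intros)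
  then show ?thesis
    unfolding primal_norm_def by (intro continuous_intros)
qed

text \<open>Along a segment, the convexity inequality for a quadratic form has slack exactly
  \<open>t * (1 - t) * B (p - q) (p - q)\<close>, which positive definiteness makes
  nonnegative.\<close>

lemma convex_on_primal_norm_power2:
  fixes B :: "'a::euclidean_space \<Rightarrow> 'a \<Rightarrow>\<^sub>L real"
  assumes "self_adjoint_pos_def B"
  shows "convex_on UNIV (\<lambda>z. (primal_norm B (z - c))\<^sup>2)"
proof (rule convex_onI)
  fix t :: real and u v :: 'a
  assume t: "0 < t" "t < 1"
  have lin: "linear B" and sym: "\<And>p q. B p q = B q p"
    using assms by (auto simp: self_adjoint_pos_def_def)
  define p q where "p = u - c" and "q = v - c"
  have "((1 - t) *\<^sub>R u + t *\<^sub>R v) - c = (1 - t) *\<^sub>R p + t *\<^sub>R q"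
    by (simp add: p_def q_def algebra_simps)
  moreover have "B ((1 - t) *\<^sub>R p + t *\<^sub>R q) ((1 - t) *\<^sub>R p + t *\<^sub>R q)
      = (1 - t) * B p p + t * B q q - t * (1 - t) * B (p - q) (p - q)"
    by (simp add: linear_add[OF lin] linear_scale[OF lin] linear_diff[OF lin] blinfun.add_left
        blinfun.diff_left blinfun.diff_right blinfun.scaleR_left blinfun.add_right
        blinfun.scaleR_right sym[of q p] algebra_simps)
  moreover have "t * (1 - t) * B (p - q) (p - q) \<ge> 0"
    using t self_adjoint_pos_def_nonneg[OF assms] by simp
  ultimately show "(primal_norm B ((1 - t) *\<^sub>R u + t *\<^sub>R v - c))\<^sup>2
      \<le> (1 - t) * (primal_norm B (u - c))\<^sup>2 + t * (primal_norm B (v - c))\<^sup>2"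
    by (simp add: primal_norm_power2[OF assms] p_def q_def)
qed simp

text \<open>Half of the equivalence of norms: by homogeneity, \<open>primal_norm B\<close> dominates
  the class norm times its own minimum on the compact unit sphere, and that minimum is
  positive.\<close>

lemma bounded_primal_ball:
  fixes B :: "'a::euclidean_space \<Rightarrow> 'a \<Rightarrow>\<^sub>L real"
  assumes "self_adjoint_pos_def B"
  shows "bounded (primal_ball B c r)"
proof -
  have lin: "linear B" using assms by (simp add: self_adjoint_pos_def_def)
  have "compact (sphere (0::'a) 1)" "sphere (0::'a) 1 \<noteq> {}" by auto
  moreover have "continuous_on (sphere 0 1) (primal_norm B)"
    using continuous_on_primal_norm[OF assms, of "sphere 0 1" 0] by simp
  ultimately obtain e where e: "e \<in> sphere 0 1"
    and min: "\<And>z. z \<in> sphere 0 1 \<Longrightarrow> primal_norm B e \<le> primal_norm B z"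
    using continuous_attains_inf by (metis (no_types, lifting))
  have "e \<noteq> 0" using e by auto
  then have pos: "primal_norm B e > 0"
    using assms by (simp add: primal_norm_def self_adjoint_pos_def_def)
  have below: "primal_norm B e * norm w \<le> primal_norm B w" for w
  proof (cases "w = 0")
    case True
    then show ?thesis by (simp add: primal_norm_def)
  next
    case False
    have "primal_norm B w = norm w * primal_norm B (w /\<^sub>R norm w)"
      using False by (simp add: primal_norm_def linear_scale[OF lin] blinfun.scaleR_left
          blinfun.scaleR_right real_sqrt_mult real_sqrt_divide field_simps)
    moreover have "primal_norm B e \<le> primal_norm B (w /\<^sub>R norm w)"
      using False by (intro min) simp
    ultimately show ?thesis by (simp add: mult.commute mult_left_mono)
  qed
  have "primal_ball B c r \<subseteq> cball c (r / primal_norm B e)"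
  proof
    fix z assume "z \<in> primal_ball B c r"
    then have "primal_norm B e * norm (z - c) \<le> r"
      using below[of "z - c"] by (simp add: primal_ball_def)
    then show "z \<in> cball c (r / primal_norm B e)"
      using pos by (simp add: dist_norm norm_minus_commute field_simps)
  qed
  then show ?thesis using bounded_subset bounded_cball by blast
qed

section \<open>Maxima and dual multipliers\<close>

lemma has_maximum_maximum:
  assumes "has_maximum f S m"
  shows "maximum f S = m"
  unfolding maximum_def
  using assms by (intro the_equality) (auto simp: has_maximum_def intro: antisym)

lemma has_maximum_compact:
  fixes f :: "'a::topological_space \<Rightarrow> real"
  assumes "compact S" "S \<noteq> {}" "continuous_on S f"
  shows "\<exists>m. has_maximum f S m"
  using continuous_attains_sup[OF assms] by (auto simp: has_maximum_def)

text \<open>Strong Lagrange duality for one affine constraint. Strictly feasible points bound the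
  multiplier from above, infeasible ones from below; convexity makes every lower bound at most every
  upper bound, and the Slater point \<open>v\<close> provides at least one upper bound.\<close>

lemma dual_multiplier_exists:
  fixes C :: "'a::euclidean_space set" and h s :: "'a \<Rightarrow>\<^sub>L real"
  assumes "compact C" and "convex C"
    and slater: "v \<in> C" "h (v - c) < 0"
  shows "\<exists>\<mu>. dual_multiplier C c h s \<mu>"
proof -
  let ?cut = "{z \<in> C. h (z - c) \<le> 0}"
  have "?cut = C \<inter> {z. h (z - c) \<le> 0}" by auto
  moreover have "closed {z. h (z - c) \<le> 0}" by (intro closed_Collect_le continuous_intros)
  ultimately have "compact ?cut" using \<open>compact C\<close> by (simp add: compact_Int_closed)
  moreover have "?cut \<noteq> {}" using slater by force
  moreover have "continuous_on ?cut (\<lambda>z. s z)" by (intro continuous_intros)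
  ultimately obtain p where p: "has_maximum (\<lambda>z. s z) ?cut p" using has_maximum_compact by blast
  then obtain w where w: "w \<in> C" "h (w - c) \<le> 0" "s w = p" by (auto simp: has_maximum_def)
  have le_p: "s z \<le> p" if "z \<in> C" "h (z - c) \<le> 0" for z
    using p that by (auto simp: has_maximum_def)
  \<comment> \<open>The largest value satisfying all upper bounds: for \<open>h (z - c) < 0\<close>,
    the desired \<open>s z + \<mu> * h (c - z) \<le> p\<close> says that \<mu> is at most this
    quotient.\<close>
  define \<mu> where "\<mu> = (INF z \<in> {z \<in> C. h (z - c) < 0}. (p - s z) / - h (z - c))"
  have ne: "{z \<in> C. h (z - c) < 0} \<noteq> {}" using slater by blast
  have nonneg: "(p - s z) / - h (z - c) \<ge> 0" if "z \<in> {z \<in> C. h (z - c) < 0}" for z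
    using that le_p[of z] by (intro divide_nonneg_pos) auto
  have "\<mu> \<ge> 0" unfolding \<mu>_def using ne nonneg by (intro cINF_greatest) auto
  have upper: "s z + \<mu> * h (c - z) \<le> p" if "z \<in> C" for z
  proof -
    have flip: "h (c - z) = - h (z - c)" by (simp add: blinfun.diff_right)
    consider "h (z - c) < 0" | "h (z - c) = 0" | "h (z - c) > 0" by linarith
    then show ?thesis
    proof cases
      case 1
      have "\<mu> \<le> (p - s z) / - h (z - c)"
        unfolding \<mu>_def using 1 that nonneg by (intro cINF_lower bdd_belowI2[where m = 0]) auto
      then show ?thesis using 1 flip by (simp add: field_simps)
    next
      case 2
      then show ?thesis using le_p[OF that] flip by simp
    next
      case 3
      \<comment> \<open>At an infeasible point the desired inequality is a lower bound on \<mu>, so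
        it has to lie below every quotient in the infimum.\<close>
      have "(s z - p) / h (z - c) \<le> \<mu>"
        unfolding \<mu>_def
      proof (rule cINF_greatest[OF ne])
        fix y assume "y \<in> {z \<in> C. h (z - c) < 0}"
        then have y: "y \<in> C" "h (y - c) < 0" by auto
        \<comment> \<open>The segment from y to z meets the hyperplane, where the bound p applies.\<close>
        define t where "t = h (z - c) / (h (z - c) - h (y - c))"
        have t: "0 \<le> t" "t \<le> 1" using 3 y(2) by (auto simp: t_def field_simps)
        have "t *\<^sub>R y + (1 - t) *\<^sub>R z \<in> C"
          using convexD[OF \<open>convex C\<close> y(1) that, of t "1 - t"] t by simp
        moreover have "h (t *\<^sub>R y + (1 - t) *\<^sub>R z - c) = t * h (y - c) + (1 - t) * h (z - c)"
          by (simp add: blinfun.diff_right blinfun.add_right blinfun.scaleR_right algebra_simps)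
        moreover have "t * h (y - c) + (1 - t) * h (z - c) = 0"
          using 3 y(2) by (simp add: t_def field_simps)
        ultimately have "s (t *\<^sub>R y + (1 - t) *\<^sub>R z) \<le> p" by (intro le_p) auto
        then have "t * s y + (1 - t) * s z \<le> p"
          by (simp add: blinfun.add_right blinfun.scaleR_right)
        then have "(h (z - c) - h (y - c)) * (t * s y + (1 - t) * s z)
            \<le> (h (z - c) - h (y - c)) * p"
          using 3 y(2) by (intro mult_left_mono) auto
        moreover have "(h (z - c) - h (y - c)) * t = h (z - c)"
          using 3 y(2) by (simp add: t_def)
        moreover have "(h (z - c) - h (y - c)) * (t * s y + (1 - t) * s z)
            = (h (z - c) - h (y - c)) * t * s y
              + (h (z - c) - h (y - c) - (h (z - c) - h (y - c)) * t) * s z"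
          by (simp add: algebra_simps)
        ultimately have "h (z - c) * s y - h (y - c) * s z \<le> (h (z - c) - h (y - c)) * p"
          by simp
        then show "(s z - p) / h (z - c) \<le> (p - s y) / - h (y - c)"
          using 3 y(2) by (simp add: divide_simps algebra_simps)
      qed
      then show ?thesis using 3 flip by (simp add: field_simps)
    qed
  qed
  \<comment> \<open>Complementary slackness: the penalty term at the maximizer \<open>w\<close> of
    the cut is nonnegative, and \<open>upper\<close> then forces it to vanish, so the value
    \<open>p\<close> is attained over all of \<open>C\<close>.\<close>
  have "\<mu> * h (c - w) \<ge> 0" using \<open>\<mu> \<ge> 0\<close> w(2) by (simp add: blinfun.diff_right)
  then have "s w + \<mu> * h (c - w) = p" using upper[OF w(1)] w(3) by linarith
  then have "has_maximum (\<lambda>z. s z + \<mu> * h (c - z)) C p"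
    using w(1) upper by (auto simp: has_maximum_def)
  then show ?thesis using p \<open>\<mu> \<ge> 0\<close> by (auto simp: dual_multiplier_def)
qed

text \<open>Induction upwards in \<open>j\<close>, against the order in which the algorithm works:
  the equality of maxima trades a witness in \<open>Q j\<close> for one in its cut, which lies in
  \<open>Q (Suc j)\<close>.\<close>

lemma augmentation_run_bound:
  assumes run: "augmentation_run Q x g k sk 0 s \<mu>"
    and cut: "\<And>i. i < k \<Longrightarrow> {z \<in> Q i. g i (z - x i) \<le> 0} \<subseteq> Q (Suc i)"
    and z: "z \<in> Q 0"
  shows "\<exists>y\<in>Q k. (\<Sum>i<k. \<mu> i * g i (x i - z)) + sk z \<le> sk y"
proof -
  have "\<exists>y\<in>Q j. (\<Sum>i<j. \<mu> i * g i (x i - z)) + s j z \<le> s j y" if "j \<le> k" for j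
    using that
  proof (induction j)
    case 0
    then show ?case using z by auto
  next
    case (Suc j)
    then obtain y where y: "y \<in> Q j" "(\<Sum>i<j. \<mu> i * g i (x i - z)) + s j z \<le> s j y"
      by auto
    from run Suc.prems have dm: "dual_multiplier (Q j) (x j) (g j) (s (Suc j)) (\<mu> j)"
      and sj: "s j = s (Suc j) - \<mu> j *\<^sub>R g j"
      by (auto simp: augmentation_run_def)
    from dm y(1) obtain y' where y': "y' \<in> Q j" "g j (y' - x j) \<le> 0"
      and le: "s (Suc j) y + \<mu> j * g j (x j - y) \<le> s (Suc j) y'"
      by (auto simp: dual_multiplier_def has_maximum_def)
    have "y' \<in> Q (Suc j)" using cut[of j] Suc.prems y' by auto
    \<comment> \<open>Substitute \<open>s j\<close> in the induction hypothesis and add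
      \<open>\<mu> j * g j (x j)\<close> to both sides; the right side becomes the left side of
      \<open>le\<close>.\<close>
    moreover have "(\<Sum>i<Suc j. \<mu> i * g i (x i - z)) + s (Suc j) z \<le> s (Suc j) y'"
      using y(2) le
      by (simp add: sj blinfun.diff_right blinfun.diff_left blinfun.scaleR_left algebra_simps)
    ultimately show ?case by blast
  qed
  from this[of k] show ?thesis using run by (simp add: augmentation_run_def)
qed

section \<open>The localization sets of the General Scheme\<close>

lemma reached_mono: "reached B \<delta> g U k \<Longrightarrow> i \<le> k \<Longrightarrow> reached B \<delta> g U i"
  by (simp add: reached_def)

text \<open>Fixes one solution \<open>xs\<close>; it will be a common point of all localization sets
  of reached iterations, so that these are nonempty.\<close>

locale general_scheme_run =
  fixes B :: "'a::euclidean_space \<Rightarrow> 'a \<Rightarrow>\<^sub>L real"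
    and G :: "'a \<Rightarrow> 'a \<Rightarrow>\<^sub>L real"
    and x0 xs :: 'a
    and R \<delta> :: real
    and a b U :: "nat \<Rightarrow> real"
    and x :: "nat \<Rightarrow> 'a"
    and g :: "nat \<Rightarrow> 'a \<Rightarrow>\<^sub>L real"
    and ell \<omega> :: "nat \<Rightarrow> 'a \<Rightarrow> real"
  assumes B: "self_adjoint_pos_def B"
    and R: "R > 0"
    and xs_ball: "xs \<in> primal_ball B x0 R"
    and xs_solution: "\<And>y. G y (y - xs) \<ge> 0"
    and \<delta>: "\<delta> > 0"
    and scheme: "general_scheme B G x0 R \<delta> a b x g U ell \<omega>"
begin

abbreviation "Om \<equiv> Omega_set R \<omega>"
abbreviation "Q k \<equiv> Om k \<inter> L_minus ell k"
abbreviation "is_reached \<equiv> reached B \<delta> g U"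

lemma steps:
  assumes "is_reached (Suc k)"
  shows "a k \<ge> 0" "b k \<ge> 0"
    and "ell (Suc k) z = ell k z + a k * g k (z - x k)"
    and "\<omega> (Suc k) z = \<omega> k z + 1/2 * b k * (U k - g k (x k - z)) * g k (z - x k)"
  using scheme assms unfolding general_scheme_def by blast+

section \<open>Convexity and compactness of the localization sets\<close>

lemma ell_eq:
  assumes "is_reached k"
  shows "ell k z = (\<Sum>i<k. a i * g i (z - x i))"
  using assms
proof (induction k)
  case 0
  then show ?case using scheme by (simp add: general_scheme_def)
next
  case (Suc k)
  then show ?case using steps(3)[OF Suc.prems] reached_mono[OF Suc.prems, of k] by simp
qed

text \<open>Each update adds a convex quadratic that is bounded below. The last conjunct, growth
  like the squared primal norm up to a constant, is what bounds the sublevel sets.\<close>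

lemma omega_regular:
  assumes "is_reached k"
  shows "continuous_on UNIV (\<omega> k) \<and> convex_on UNIV (\<omega> k) \<and>
    (\<exists>C. \<forall>z. (primal_norm B (z - x0))\<^sup>2 \<le> 2 * \<omega> k z + C)"
  using assms
proof (induction k)
  case 0
  have "\<omega> 0 = (\<lambda>z. 1/2 * (primal_norm B (z - x0))\<^sup>2)"
    using scheme by (auto simp: general_scheme_def)
  then show ?case
    using convex_on_primal_norm_power2[OF B, of x0]
    by (auto intro!: continuous_intros continuous_on_primal_norm[OF B] convex_on_cmul
        exI[where x = 0])
next
  case (Suc k)
  from Suc.IH reached_mono[OF Suc.prems] obtain C
    where cont: "continuous_on UNIV (\<omega> k)" and conv: "convex_on UNIV (\<omega> k)"
      and C: "\<And>z. (primal_norm B (z - x0))\<^sup>2 \<le> 2 * \<omega> k z + C"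
    by auto
  have bk: "b k \<ge> 0" using steps(2)[OF Suc.prems] .
  \<comment> \<open>With \<open>p = g k (z - x k)\<close>, the factor
    \<open>U k - g k (x k - z)\<close> is \<open>U k + p\<close>, so the update is
    \<open>b k / 2\<close> times \<open>p * p + U k * p\<close>.\<close>
  define q where "q z = (g k (z - x k))\<^sup>2 + U k * g k (z - x k)" for z
  have eq: "\<omega> (Suc k) z = \<omega> k z + 1/2 * b k * q z" for z
  proof -
    have "g k (x k - z) = - g k (z - x k)" by (simp add: blinfun.diff_right)
    then show ?thesis
      unfolding steps(4)[OF Suc.prems, of z] q_def by (simp add: power2_eq_square algebra_simps)
  qed
  have "continuous_on UNIV (\<omega> (Suc k))"
    unfolding eq q_def by (intro continuous_intros cont)
  moreover have "convex_on UNIV (\<omega> (Suc k))"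
  proof -
    have "convex_on UNIV q"
    proof (rule convex_onI)
      fix t :: real and u v :: 'a
      assume t: "0 < t" "t < 1"
      define p r where "p = g k (u - x k)" and "r = g k (v - x k)"
      have "g k ((1 - t) *\<^sub>R u + t *\<^sub>R v - x k) = (1 - t) * p + t * r"
        by (simp add: p_def r_def blinfun.diff_right blinfun.add_right blinfun.scaleR_right
            algebra_simps)
      moreover have "((1 - t) * p + t * r)\<^sup>2 = (1 - t) * p\<^sup>2 + t * r\<^sup>2 - t * (1 - t) * (p - r)\<^sup>2"
        by (simp add: power2_eq_square algebra_simps)
      moreover have "t * (1 - t) * (p - r)\<^sup>2 \<ge> 0" using t by simp
      ultimately show "q ((1 - t) *\<^sub>R u + t *\<^sub>R v) \<le> (1 - t) * q u + t * q v"
        by (simp add: q_def flip: p_def r_def) (simp add: algebra_simps)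
    qed simp
    then have "convex_on UNIV (\<lambda>z. \<omega> k z + 1/2 * b k * q z)"
      using bk conv by (intro convex_on_add convex_on_cmul) auto
    then show ?thesis using eq by presburger
  qed
  moreover have "(primal_norm B (z - x0))\<^sup>2 \<le> 2 * \<omega> (Suc k) z + (C + b k * ((U k)\<^sup>2 / 4))" for z
  proof -
    \<comment> \<open>Completing the square explains the increase of the constant \<open>C\<close>
      by \<open>b k * ((U k)\<^sup>2 / 4)\<close>.\<close>
    have "q z + (U k)\<^sup>2 / 4 = (g k (z - x k) + U k / 2)\<^sup>2"
      by (simp add: q_def power2_eq_square field_simps)
    then have "b k * (q z + (U k)\<^sup>2 / 4) \<ge> 0" using bk by simp
    then show ?thesis using C[of z] eq[of z] by (simp add: algebra_simps)
  qed
  ultimately show ?case by blast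
qed

lemma compact_Omega:
  assumes "is_reached k"
  shows "compact (Om k)"
proof -
  from omega_regular[OF assms] obtain C where cont: "continuous_on UNIV (\<omega> k)"
    and C: "\<And>z. (primal_norm B (z - x0))\<^sup>2 \<le> 2 * \<omega> k z + C"
    by blast
  have "Om k \<subseteq> primal_ball B x0 (sqrt (R\<^sup>2 + C))"
  proof
    fix z assume "z \<in> Om k"
    then have "(primal_norm B (z - x0))\<^sup>2 \<le> R\<^sup>2 + C" using C[of z] by (simp add: Omega_set_def)
    then show "z \<in> primal_ball B x0 (sqrt (R\<^sup>2 + C))"
      by (simp add: primal_ball_def real_le_rsqrt)
  qed
  then have "bounded (Om k)" using bounded_primal_ball[OF B] bounded_subset by blast
  moreover have "closed (Om k)"
    unfolding Omega_set_def by (intro closed_Collect_le cont continuous_intros)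
  ultimately show ?thesis by (simp add: compact_eq_bounded_closed)
qed

lemma compact_Q:
  assumes "is_reached k"
  shows "compact (Q k)"
proof -
  have "closed (L_minus ell k)"
    unfolding L_minus_def ell_eq[OF assms] by (intro closed_Collect_le continuous_intros)
  then show ?thesis using compact_Omega[OF assms] by (simp add: compact_Int_closed)
qed

lemma convex_Q:
  assumes "is_reached k"
  shows "convex (Q k)"
proof -
  have conv: "convex_on UNIV (\<omega> k)" using omega_regular[OF assms] by blast
  have "convex (Om k)"
  proof (rule convexI)
    fix u v :: 'a and p q :: real
    assume uv: "u \<in> Om k" "v \<in> Om k" and pq: "0 \<le> p" "0 \<le> q" "p + q = 1"
    have "\<omega> k (p *\<^sub>R u + q *\<^sub>R v) \<le> p * \<omega> k u + q * \<omega> k v"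
      using conv pq by (simp add: convex_on_def)
    also have "\<dots> \<le> 1/2 * R\<^sup>2"
      using uv pq by (intro convex_bound_le) (auto simp: Omega_set_def)
    finally show "p *\<^sub>R u + q *\<^sub>R v \<in> Om k" by (simp add: Omega_set_def)
  qed
  moreover have "convex (L_minus ell k)"
  proof -
    \<comment> \<open>\<open>ell k\<close> is affine, so \<open>L_minus ell k\<close> is the
      preimage of a half-line under a linear functional.\<close>
    have "ell k z = (\<Sum>i<k. a i *\<^sub>R g i) z - (\<Sum>i<k. a i * g i (x i))" for z
      by (simp add: ell_eq[OF assms] blinfun.sum_left blinfun.scaleR_left blinfun.diff_right
          right_diff_distrib sum_subtractf)
    then have "L_minus ell k =
        (\<lambda>z. (\<Sum>i<k. a i *\<^sub>R g i) z) -` {..(\<Sum>i<k. a i * g i (x i))}"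
      by (auto simp: L_minus_def)
    then show ?thesis
      by (simp add: convex_linear_vimage bounded_linear.linear[OF blinfun.bounded_linear_right])
  qed
  ultimately show ?thesis by (rule convex_Int)
qed

text \<open>Endpoint of the telescoping: \<open>ell 0\<close> vanishes, so only the bound on
  \<open>\<omega> 0\<close> remains, a comparison of squares of nonnegative numbers.\<close>

lemma Q_0: "Q 0 = primal_ball B x0 R"
proof -
  have "primal_norm B z \<ge> 0" for z
    using self_adjoint_pos_def_nonneg[OF B] by (simp add: primal_norm_def)
  then show ?thesis
    using scheme R
    by (auto simp: general_scheme_def Omega_set_def L_minus_def primal_ball_def
        power2_le_iff_abs_le)
qed

section \<open>Cuts, the solution and strict feasibility\<close>

lemma g_at_solution:
  assumes "is_reached k"
  shows "g k (x k - xs) \<ge> 0"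
  using scheme assms xs_solution by (simp add: general_scheme_def)

text \<open>Turns the value of \<open>maximum\<close>, a definite description, into a maximum that
  is really attained.\<close>

lemma U_has_maximum:
  assumes "is_reached k" "Q k \<noteq> {}"
  shows "has_maximum (\<lambda>z. g k (x k - z)) (Q k) (U k)"
proof -
  have "continuous_on (Q k) (\<lambda>z. g k (x k - z))" by (intro continuous_intros)
  then obtain m where m: "has_maximum (\<lambda>z. g k (x k - z)) (Q k) m"
    using has_maximum_compact compact_Q[OF assms(1)] assms(2) by metis
  moreover have "U k = maximum (\<lambda>z. g k (x k - z)) (Q k)"
    using scheme assms(1) by (simp add: general_scheme_def)
  ultimately show ?thesis using has_maximum_maximum by metis
qed

text \<open>On the cut both updates are products of a nonnegative and a nonpositive factor; for
  \<omega>, the sign of \<open>U k - g k (x k - z)\<close> comes from \<open>U k\<close> being the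
  maximum over \<open>Q k\<close>.\<close>

lemma cut_subset:
  assumes "is_reached (Suc k)"
  shows "{z \<in> Q k. g k (z - x k) \<le> 0} \<subseteq> Q (Suc k)"
proof
  fix z assume "z \<in> {z \<in> Q k. g k (z - x k) \<le> 0}"
  then have z: "z \<in> Q k" "g k (z - x k) \<le> 0" by auto
  note st = steps[OF assms]
  have "U k - g k (x k - z) \<ge> 0"
    using U_has_maximum[OF reached_mono[OF assms, of k]] z(1) by (auto simp: has_maximum_def)
  then have "1/2 * b k * (U k - g k (x k - z)) * g k (z - x k) \<le> 0"
    using st(2) z(2) by (intro mult_nonneg_nonpos) auto
  moreover have "a k * g k (z - x k) \<le> 0" using st(1) z(2) by (rule mult_nonneg_nonpos)
  ultimately show "z \<in> Q (Suc k)"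
    using z(1) by (simp add: Omega_set_def L_minus_def st(3,4))
qed

text \<open>The assumed inequality at \<open>xs\<close> says that \<open>xs\<close> survives every
  cut.\<close>

lemma solution_in_Q:
  assumes "is_reached k"
  shows "xs \<in> Q k"
  using assms
proof (induction k)
  case 0
  then show ?case using Q_0 xs_ball by simp
next
  case (Suc k)
  have r: "is_reached k" using reached_mono[OF Suc.prems] by simp
  have "g k (xs - x k) \<le> 0" using g_at_solution[OF r] by (simp add: blinfun.diff_right)
  then show ?case using Suc.IH[OF r] cut_subset[OF Suc.prems] by blast
qed

text \<open>Reaching \<open>Suc k\<close> means that iteration \<open>k\<close> failed the
  termination test, hence \<open>U k > 0\<close>; a point attaining \<open>U k\<close> is strictly
  feasible.\<close>

lemma slater_point:
  assumes "is_reached (Suc k)"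
  shows "\<exists>v\<in>Q k. g k (v - x k) < 0"
proof -
  have r: "is_reached k" using reached_mono[OF assms] by simp
  have "U k > \<delta> * dual_norm B (g k)" using assms by (simp add: reached_def terminal_def not_le)
  moreover have "\<delta> * dual_norm B (g k) \<ge> 0" using \<delta> dual_norm_nonneg[OF B] by simp
  ultimately have "U k > 0" by linarith
  obtain v where v: "v \<in> Q k" "g k (x k - v) = U k"
    using U_has_maximum[OF r] solution_in_Q[OF r] unfolding has_maximum_def by blast
  have "g k (v - x k) < 0" using \<open>U k > 0\<close> v(2) by (simp add: blinfun.diff_right)
  then show ?thesis using v(1) by blast
qed

section \<open>The Augmentation Algorithm along a run of the scheme\<close>

lemma augmentation_well_defined:
  assumes "is_reached k"
  shows "augmentation_well_defined Q x g k sk"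
  unfolding augmentation_well_defined_def
proof (intro allI impI)
  fix j and s :: "nat \<Rightarrow> 'a \<Rightarrow>\<^sub>L real" and \<mu> :: "nat \<Rightarrow> real"
  assume "j < k \<and> augmentation_run Q x g k sk (Suc j) s \<mu>"
  \<comment> \<open>Strict \<open>j < k\<close> makes iteration \<open>j\<close> nonterminal, even
    when \<open>k\<close> itself is terminal. The functional \<open>s (Suc j)\<close> may be
    arbitrary, so earlier choices of multipliers do not matter.\<close>
  then have r: "is_reached (Suc j)" using reached_mono[OF assms] by simp
  have rj: "is_reached j" using reached_mono[OF r] by simp
  obtain v where "v \<in> Q j" "g j (v - x j) < 0" using slater_point[OF r] by blast
  then show "\<exists>m. dual_multiplier (Q j) (x j) (g j) (s (Suc j)) m"
    by (rule dual_multiplier_exists[OF compact_Q[OF rj] convex_Q[OF rj]])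
qed

lemma run_bound:
  assumes "is_reached k" "augmentation_run Q x g k sk 0 s \<mu>" "z \<in> primal_ball B x0 R"
  obtains y where "y \<in> Q k" "(\<Sum>i<k. \<mu> i * g i (x i - z)) + sk z \<le> sk y"
proof -
  have "{z \<in> Q i. g i (z - x i) \<le> 0} \<subseteq> Q (Suc i)" if "i < k" for i
    using cut_subset reached_mono[OF assms(1)] that by simp
  then have "\<exists>y\<in>Q k. (\<Sum>i<k. \<mu> i * g i (x i - z)) + sk z \<le> sk y"
    using augmentation_run_bound[OF assms(2)] assms(3) Q_0 by simp
  then show thesis using that by blast
qed

lemma run_multiplier_nonneg:
  "augmentation_run Q x g k sk 0 s \<mu> \<Longrightarrow> i < k \<Longrightarrow> \<mu> i \<ge> 0"
  by (auto simp: augmentation_run_def dual_multiplier_def)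

section \<open>Gaps of the augmented certificates\<close>

lemma continuous_on_gap_function: "continuous_on S (gap_function B x g c n)"
  unfolding gap_function_def by (intro continuous_intros)

lemma gap_attained_on_ball:
  "\<exists>M. has_maximum (gap_function B x g c n) (primal_ball B x0 R) M"
proof -
  have "is_reached 0" by (simp add: reached_def)
  then have "compact (primal_ball B x0 R)" using compact_Q Q_0 by metis
  moreover have "primal_ball B x0 R \<noteq> {}" using xs_ball by blast
  ultimately show ?thesis using has_maximum_compact continuous_on_gap_function by blast
qed

text \<open>The telescoped bound compares the unnormalized sums. The passage to the larger weight
  \<open>weight_sum B g lam k\<close> is harmless because \<Delta> is nonnegative, as evaluation at
  \<open>xs\<close> shows.\<close>

lemma augmented_gap_le_sliding_gap:
  assumes r: "is_reached k" and pos: "weight_sum B g a k > 0"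
    and run: "augmentation_run Q x g k (- (\<Sum>i<k. a i *\<^sub>R g i)) 0 s \<mu>"
  defines "lam \<equiv> \<lambda>i. a i + \<mu> i"
  shows "weight_sum B g lam k \<ge> weight_sum B g a k"
    and "\<exists>M \<Delta>. has_maximum (gap_function B x g lam k) (primal_ball B x0 R) M \<and>
      is_sliding_gap B R a x g \<omega> k \<Delta> \<and> M \<le> \<Delta>"
proof -
  show le: "weight_sum B g lam k \<ge> weight_sum B g a k"
    unfolding weight_sum_def lam_def
    using run_multiplier_nonneg[OF run] dual_norm_nonneg[OF B]
    by (intro sum_mono mult_right_mono) auto
  obtain M where M: "has_maximum (gap_function B x g lam k) (primal_ball B x0 R) M"
    using gap_attained_on_ball by blast
  have "Om k \<noteq> {}" using solution_in_Q[OF r] by blast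
  then obtain \<Delta> where \<Delta>: "has_maximum (gap_function B x g a k) (Om k) \<Delta>"
    using has_maximum_compact compact_Omega[OF r] continuous_on_gap_function by blast
  have sum_le: "(\<Sum>i<k. a i * g i (x i - y)) \<le> weight_sum B g a k * \<Delta>" if "y \<in> Om k" for y
    using \<Delta> that pos by (auto simp: has_maximum_def gap_function_def field_simps)
  have "(\<Sum>i<k. a i * g i (x i - xs)) \<ge> 0"
  proof (rule sum_nonneg)
    fix i assume "i \<in> {..<k}"
    then have i: "is_reached (Suc i)" using reached_mono[OF r] by simp
    then show "a i * g i (x i - xs) \<ge> 0"
      using steps(1) g_at_solution reached_mono[OF i, of i] by simp
  qed
  then have "weight_sum B g a k * \<Delta> \<ge> 0" using sum_le[of xs] solution_in_Q[OF r] by simp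
  then have "\<Delta> \<ge> 0" using pos by (simp add: zero_le_mult_iff)
  from M obtain z where z: "z \<in> primal_ball B x0 R" "gap_function B x g lam k z = M"
    by (auto simp: has_maximum_def)
  obtain y where y: "y \<in> Q k"
    and bound: "(\<Sum>i<k. \<mu> i * g i (x i - z)) + (- (\<Sum>i<k. a i *\<^sub>R g i)) z
      \<le> (- (\<Sum>i<k. a i *\<^sub>R g i)) y"
    using run_bound[OF r run z(1)] .
  \<comment> \<open>Adding the constant sum of \<open>a i * g i (x i)\<close> to both sides of
    \<open>bound\<close> completes the terms with weights \<open>a i\<close>.\<close>
  have "(\<Sum>i<k. lam i * g i (x i - z)) \<le> (\<Sum>i<k. a i * g i (x i - y))"
    using bound
    by (simp add: lam_def blinfun.minus_left blinfun.sum_left blinfun.scaleR_left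
        blinfun.diff_right algebra_simps sum.distrib sum_subtractf)
  also have "\<dots> \<le> weight_sum B g a k * \<Delta>" using y sum_le by simp
  also have "\<dots> \<le> weight_sum B g lam k * \<Delta>" using le \<open>\<Delta> \<ge> 0\<close> by (rule mult_right_mono)
  finally have "M \<le> \<Delta>"
    using z(2) le pos by (auto simp: gap_function_def field_simps)
  then show "\<exists>M \<Delta>. has_maximum (gap_function B x g lam k) (primal_ball B x0 R) M \<and>
      is_sliding_gap B R a x g \<omega> k \<Delta> \<and> M \<le> \<Delta>"
    using M \<Delta> by (auto simp: is_sliding_gap_def)
qed

text \<open>The bound telescopes to \<open>g k (x k - y)\<close> with \<open>y\<close> in
  \<open>Q k\<close>, which \<open>U k\<close> and then the termination test control. Since
  \<open>g k\<close> has weight 1 and is nonzero, the total weight is positive even if all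
  multipliers vanish.\<close>

lemma terminal_gap_le:
  assumes r: "is_reached k" and terminal: "terminal B \<delta> g U k" and nz: "g k \<noteq> 0"
    and run: "augmentation_run Q x g k (- g k) 0 s \<mu>"
  \<comment> \<open>The run constrains \<open>\<mu> i\<close> only for \<open>i < k\<close>, so the
    entry at \<open>k\<close> is free to be overwritten.\<close>
  defines "lam \<equiv> \<mu>(k := 1)"
  shows "\<exists>M. has_maximum (gap_function B x g lam (Suc k)) (primal_ball B x0 R) M \<and> M \<le> \<delta>"
proof -
  obtain M where M: "has_maximum (gap_function B x g lam (Suc k)) (primal_ball B x0 R) M"
    using gap_attained_on_ball by blast
  then obtain z where z: "z \<in> primal_ball B x0 R" "gap_function B x g lam (Suc k) z = M"
    by (auto simp: has_maximum_def)
  have "(\<Sum>i<k. \<mu> i * dual_norm B (g i)) \<ge> 0"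
    using run_multiplier_nonneg[OF run] dual_norm_nonneg[OF B] by (intro sum_nonneg) auto
  then have ge: "dual_norm B (g k) \<le> weight_sum B g lam (Suc k)"
    by (simp add: weight_sum_def lam_def)
  then have pos: "weight_sum B g lam (Suc k) > 0"
    using dual_norm_pos[OF B nz] by linarith
  obtain y where y: "y \<in> Q k"
    and bound: "(\<Sum>i<k. \<mu> i * g i (x i - z)) + (- g k) z \<le> (- g k) y"
    using run_bound[OF r run z(1)] .
  have "(\<Sum>i<Suc k. lam i * g i (x i - z)) \<le> g k (x k - y)"
    using bound by (simp add: lam_def blinfun.minus_left blinfun.diff_right)
  also have "\<dots> \<le> U k" using U_has_maximum[OF r] y by (auto simp: has_maximum_def)
  also have "\<dots> \<le> \<delta> * dual_norm B (g k)" using terminal by (simp add: terminal_def)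
  also have "\<dots> \<le> \<delta> * weight_sum B g lam (Suc k)" using ge \<delta> by simp
  finally have "M \<le> \<delta>" using z(2) pos by (auto simp: gap_function_def field_simps)
  then show ?thesis using M by blast
qed

end

theorem mainTheorem3:
  fixes B :: "'a::euclidean_space \<Rightarrow> 'a \<Rightarrow>\<^sub>L real"
    and G :: "'a \<Rightarrow> 'a \<Rightarrow>\<^sub>L real"
    and x0 :: 'a
    and R \<delta> :: real
    and a b U :: "nat \<Rightarrow> real"
    and x :: "nat \<Rightarrow> 'a"
    and g :: "nat \<Rightarrow> 'a \<Rightarrow>\<^sub>L real"
    and ell \<omega> :: "nat \<Rightarrow> 'a \<Rightarrow> real"
    and Q :: "nat \<Rightarrow> 'a set"
  assumes B: "self_adjoint_pos_def B"
    and R: "R > 0"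
    and xstar: "\<exists>xs \<in> primal_ball B x0 R. \<forall>y. G y (y - xs) \<ge> 0"
    and \<delta>: "\<delta> > 0"
    and scheme: "general_scheme B G x0 R \<delta> a b x g U ell \<omega>"
    and nonzero: "\<forall>k. reached B \<delta> g U k \<longrightarrow> g k \<noteq> 0"
    and Q: "\<forall>i. Q i = Omega_set R \<omega> i \<inter> L_minus ell i"
  shows
    "(\<forall>k\<ge>1. reached B \<delta> g U k \<and> weight_sum B g a k > 0 \<longrightarrow>
        (let sk = - (\<Sum>i<k. a i *\<^sub>R g i) in
          augmentation_well_defined Q x g k sk \<and>
          (\<forall>s \<mu>. augmentation_run Q x g k sk 0 s \<mu> \<longrightarrow>
            (let lam = (\<lambda>i. a i + \<mu> i) in
              weight_sum B g lam k \<ge> weight_sum B g a k \<and>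
              weight_sum B g a k > 0 \<and>
              (\<exists>M \<Delta>. has_maximum (gap_function B x g lam k) (primal_ball B x0 R) M \<and>
                     is_sliding_gap B R a x g \<omega> k \<Delta> \<and>
                     M \<le> \<Delta>)))))
     \<and>
     (\<forall>k. reached B \<delta> g U k \<and> terminal B \<delta> g U k \<longrightarrow>
        (let sk = - g k in
          augmentation_well_defined Q x g k sk \<and>
          (\<forall>s \<mu>. augmentation_run Q x g k sk 0 s \<mu> \<longrightarrow>
            (let lam = \<mu>(k := 1) in
              (\<exists>M. has_maximum (gap_function B x g lam (Suc k)) (primal_ball B x0 R) M \<and>
                   M \<le> \<delta>)))))"
proof -
  obtain xs where xs: "xs \<in> primal_ball B x0 R" "\<And>y. G y (y - xs) \<ge> 0" using xstar by blast
  interpret general_scheme_run B G x0 xs R \<delta> a b U x g ell \<omega>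
    using B R xs \<delta> scheme by unfold_locales
  have Q_eq: "Q = (\<lambda>i. Omega_set R \<omega> i \<inter> L_minus ell i)" using Q by blast
  show ?thesis
    unfolding Let_def Q_eq
    using augmentation_well_defined augmented_gap_le_sliding_gap terminal_gap_le nonzero
    by blast
qed

end
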